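(* Let $\lambda_1$ and $n$ be positive integers. Suppose $(\mathcal{V},\mathcal{B})$ is a $\mathrm{DK}(\lambda_1 n,\lambda_1^2)$-design with $|\mathcal{V}|=k$, say $\mathcal{V}=\{1,\dots,k\}$, and $|\mathcal{B}|=n^2$, together with two orthogonal equipartitions $\mathcal{P}_1=\{R_1,\dots,R_n\}$ and $\mathcal{P}_2=\{C_1,\dots,C_n\}$ of $\mathcal{B}$, each of type $n^n$. For $1\le i,j\le n$ let $B_{i,j}$ be the unique block in $R_i\cap C_j$, and for $1\le x\le k$ let $F_x$ be the $n\times n$ $(0,1)$-matrix whose cell $(i,j)$ is $1$ if and only if $x\in B_{i,j}$. Then $\{F_1,\dots,F_k\}$ is a set of $k$ mutually orthogonal binary frequency squares of type $(n;n-\lambda_1,\lambda_1)$.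
   Context: A design is a pair $(\mathcal{V},\mathcal{B})$ with $\mathcal{V}$ a finite set of points and $\mathcal{B}$ a collection (multiset; repeated and empty blocks allowed) of subsets of $\mathcal{V}$. For positive integers $R,\Lambda$, a $\mathrm{DK}(R,\Lambda)$-design is a design in which every pair of distinct points occurs in exactly $\Lambda$ blocks, every point occurs in exactly $R$ blocks, and $R^2=\Lambda|\mathcal{B}|$. A partition of $\mathcal{B}$ (blocks counted with multiplicity) is an equipartition if each point occurs the same number of times among the blocks of each part (here this forces each point to occur $\lambda_1$ times in each part). Two partitions $\mathcal{P}_1,\mathcal{P}_2$ of $\mathcal{B}$ are orthogonal if $|P_1\cap P_2|\le1$ for all parts $P_1\in\mathcal{P}_1,P_2\in\mathcal{P}_2$; type $n^n$ means $n$ parts each of cardinality $n$. Under these hypotheses each $R_i\cap C_j$ contains exactly one block. A binary frequency square of type $(n;\lambda_0,\lambda_1)$ is an $n\times n$ $(0,1)$-matrix with $\lambda_0$ zeros and $\lambda_1$ ones in each row and column; two such squares are orthogonal if exactly $\lambda_1^2$ cells contain $1$ in both; mutually orthogonal means pairwise orthogonal.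
   Formalization: The squares F_x are treated as a family indexed by the k points, pairwise orthogonal for distinct points; that they are k different squares is claimed only for λ_1 < n, since for λ_1 = n every F_x is the all-ones matrix and the set {F_1,…,F_k} has one element. *)

theory Defs
  imports "Jordan_Normal_Form.Matrix" "HOL-Library.Disjoint_Sets"
begin

text \<open>
  The block collection of a design may contain repeated (and empty) blocks, so it is an indexed
  family: \<open>B\<close> is a finite set of block labels and \<open>blk b\<close> is the subset of the point set
  carried by the label \<open>b\<close>. Counting blocks with multiplicity is counting labels, and a
  partition of the block collection is a partition of \<open>B\<close>.
\<close>

definition design :: "'a set \<Rightarrow> 'b set \<Rightarrow> ('b \<Rightarrow> 'a set) \<Rightarrow> bool" where
  "design V B blk \<longleftrightarrow> finite V \<and> finite B \<and> (\<forall>b\<in>B. blk b \<subseteq> V)"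

definition DK_design :: "nat \<Rightarrow> nat \<Rightarrow> 'a set \<Rightarrow> 'b set \<Rightarrow> ('b \<Rightarrow> 'a set) \<Rightarrow> bool" where
  "DK_design r l V B blk \<longleftrightarrow>
     design V B blk \<and> 0 < r \<and> 0 < l \<and>
     (\<forall>x\<in>V. \<forall>y\<in>V. x \<noteq> y \<longrightarrow> card {b \<in> B. x \<in> blk b \<and> y \<in> blk b} = l) \<and>
     (\<forall>x\<in>V. card {b \<in> B. x \<in> blk b} = r) \<and>
     r\<^sup>2 = l * card B"

definition equipartition :: "'a set \<Rightarrow> 'b set \<Rightarrow> ('b \<Rightarrow> 'a set) \<Rightarrow> 'b set set \<Rightarrow> bool" where
  "equipartition V B blk \<P> \<longleftrightarrow>
     partition_on B \<P> \<and>
     (\<forall>x\<in>V. \<forall>P\<in>\<P>. \<forall>Q\<in>\<P>. card {b \<in> P. x \<in> blk b} = card {b \<in> Q. x \<in> blk b})"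

definition orthogonal_partitions :: "'b set set \<Rightarrow> 'b set set \<Rightarrow> bool" where
  "orthogonal_partitions \<P> \<Q> \<longleftrightarrow> (\<forall>P\<in>\<P>. \<forall>Q\<in>\<Q>. card (P \<inter> Q) \<le> 1)"

text \<open>Type \<open>m\<^sup>t\<close>: exactly \<open>t\<close> parts, each of cardinality \<open>m\<close>.\<close>

definition partition_type :: "nat \<Rightarrow> nat \<Rightarrow> 'b set set \<Rightarrow> bool" where
  "partition_type m t \<P> \<longleftrightarrow> card \<P> = t \<and> (\<forall>P\<in>\<P>. card P = m)"

definition binary_freq_square :: "nat \<Rightarrow> nat \<Rightarrow> nat \<Rightarrow> nat mat \<Rightarrow> bool" where
  "binary_freq_square n l0 l1 F \<longleftrightarrow>
     F \<in> carrier_mat n n \<and>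
     (\<forall>i<n. \<forall>j<n. F $$ (i, j) \<in> {0, 1}) \<and>
     (\<forall>i<n. card {j. j < n \<and> F $$ (i, j) = 0} = l0 \<and> card {j. j < n \<and> F $$ (i, j) = 1} = l1) \<and>
     (\<forall>j<n. card {i. i < n \<and> F $$ (i, j) = 0} = l0 \<and> card {i. i < n \<and> F $$ (i, j) = 1} = l1)"

definition orthogonal_freq_squares :: "nat \<Rightarrow> nat \<Rightarrow> nat mat \<Rightarrow> nat mat \<Rightarrow> bool" where
  "orthogonal_freq_squares n l1 F G \<longleftrightarrow>
     card {(i, j). i < n \<and> j < n \<and> F $$ (i, j) = 1 \<and> G $$ (i, j) = 1} = l1\<^sup>2"

text \<open>
  Mutual orthogonality is stated for an indexed family: for \<open>l0 = 0\<close> the all-ones square is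
  orthogonal to itself, so squares with distinct indices may then coincide.
\<close>

definition mutually_orthogonal_freq_squares ::
    "nat \<Rightarrow> nat \<Rightarrow> nat \<Rightarrow> 'a set \<Rightarrow> ('a \<Rightarrow> nat mat) \<Rightarrow> bool" where
  "mutually_orthogonal_freq_squares n l0 l1 I F \<longleftrightarrow>
     (\<forall>x\<in>I. binary_freq_square n l0 l1 (F x)) \<and>
     pairwise (\<lambda>x y. orthogonal_freq_squares n l1 (F x) (F y)) I"

text \<open>
  The label of the block in \<open>R\<^sub>i \<inter> C\<^sub>j\<close>; existence and uniqueness are shown in
  \<open>ex1_block_in_cell\<close>. Rows and columns are numbered from 0, as matrix entries are.
\<close>

definition cell_block :: "(nat \<Rightarrow> 'b set) \<Rightarrow> (nat \<Rightarrow> 'b set) \<Rightarrow> nat \<Rightarrow> nat \<Rightarrow> 'b" where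
  "cell_block R C i j = (THE b. b \<in> R i \<inter> C j)"

definition point_square ::
    "('b \<Rightarrow> 'a set) \<Rightarrow> nat \<Rightarrow> (nat \<Rightarrow> 'b set) \<Rightarrow> (nat \<Rightarrow> 'b set) \<Rightarrow> 'a \<Rightarrow> nat mat" where
  "point_square blk n R C x = mat n n (\<lambda>(i, j). if x \<in> blk (cell_block R C i j) then 1 else 0)"

lemma ex1_block_in_cell:
  assumes "finite B" "partition_on B \<P>1" "partition_on B \<P>2"
    and "partition_type n n \<P>1" "partition_type n n \<P>2" "orthogonal_partitions \<P>1 \<P>2"
    and "P \<in> \<P>1" "Q \<in> \<P>2"
  shows "\<exists>!b. b \<in> P \<inter> Q"
proof -
  have sub: "P \<subseteq> B" "Q \<subseteq> B" and un: "\<Union>\<P>2 = B"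
    using assms by (auto simp: partition_on_def)
  have fin: "finite \<P>2" using assms(1,3) finite_elements by blast
  have finP: "finite P" using sub assms(1) finite_subset by blast
  have le: "card (P \<inter> Q') \<le> 1" if "Q' \<in> \<P>2" for Q'
    using that assms(6,7) by (auto simp: orthogonal_partitions_def)
  have "P = (\<Union>Q'\<in>\<P>2. P \<inter> Q')" using sub un by blast
  then have "card P = card (\<Union>Q'\<in>\<P>2. P \<inter> Q')" by simp
  also have "\<dots> \<le> (\<Sum>Q'\<in>\<P>2. card (P \<inter> Q'))" using card_UN_le[OF fin] by blast
  also have "\<dots> = card (P \<inter> Q) + (\<Sum>Q'\<in>\<P>2 - {Q}. card (P \<inter> Q'))"
    using fin assms(8) by (simp add: sum.remove)
  also have "\<dots> \<le> card (P \<inter> Q) + (\<Sum>Q'\<in>\<P>2 - {Q}. 1)"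
    by (intro add_left_mono sum_mono le) auto
  also have "\<dots> = card (P \<inter> Q) + (n - 1)"
    using assms(5,8) fin by (simp add: partition_type_def)
  finally have "n \<le> card (P \<inter> Q) + (n - 1)"
    using assms(4,7) by (simp add: partition_type_def)
  moreover have "n > 0"
    using assms(5,8) fin card_gt_0_iff by (fastforce simp: partition_type_def)
  ultimately have "card (P \<inter> Q) = 1" using le[OF assms(8)] by linarith
  then obtain b where "P \<inter> Q = {b}" by (auto simp: card_1_singleton_iff)
  then show ?thesis by auto
qed

end

theory Submission
  imports Defs
begin

text \<open>
  The cells of the \<open>n \<times> n\<close> grid are in bijection with the blocks, row \<open>i\<close> with \<open>R\<^sub>i\<close> and column
  \<open>j\<close> with \<open>C\<^sub>j\<close>. Under this bijection the row and column sums of \<open>F\<^sub>x\<close> count the blocks through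
  \<open>x\<close> in one part, and the common ones of \<open>F\<^sub>x\<close> and \<open>F\<^sub>y\<close> are the blocks through both points.
  If \<open>F\<^sub>x = F\<^sub>y\<close> for distinct \<open>x\<close>, \<open>y\<close>, the blocks through both are all blocks through \<open>x\<close>, so
  \<open>\<lambda>\<^sub>1\<^sup>2 = \<lambda>\<^sub>1 n\<close>; hence the squares are distinct when \<open>\<lambda>\<^sub>1 < n\<close>.
\<close>

lemma card_Collect_bij_betw:
  assumes "bij_betw g A S"
  shows "card {a \<in> A. P (g a)} = card {b \<in> S. P b}"
proof (rule bij_betw_same_card)
  show "bij_betw g {a \<in> A. P (g a)} {b \<in> S. P b}"
    using assms by (auto simp: bij_betw_def inj_on_def)
qed

text \<open>The parts split the \<open>l * n\<close> blocks through \<open>x\<close> into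
  \<open>n\<close> classes, which an equipartition makes equal in size. This supplies the actual
  value behind "the same number in each part".\<close>

lemma card_blocks_through_point_in_part:
  assumes "finite B" and eq: "equipartition V B blk \<P>"
    and "card \<P> = n" and "0 < n"
    and "x \<in> V" and "P \<in> \<P>" and "card {b \<in> B. x \<in> blk b} = l * n"
  shows "card {b \<in> P. x \<in> blk b} = l"
proof -
  have part: "partition_on B \<P>"
    using eq by (simp add: equipartition_def)
  have fin: "finite \<P>"
    using finite_elements[OF assms(1) part] .
  have "{b \<in> B. x \<in> blk b} = (\<Union>Q\<in>\<P>. {b \<in> Q. x \<in> blk b})"
    using part by (auto simp: partition_on_def)
  then have "l * n = card (\<Union>Q\<in>\<P>. {b \<in> Q. x \<in> blk b})"
    using assms(7) by simp
  also have "\<dots> = (\<Sum>Q\<in>\<P>. card {b \<in> Q. x \<in> blk b})"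
  proof (rule card_UN_disjoint[OF fin])
    show "\<forall>Q\<in>\<P>. finite {b \<in> Q. x \<in> blk b}"
      using part assms(1) by (auto simp: partition_on_def intro: finite_subset)
    show "\<forall>Q\<in>\<P>. \<forall>Q'\<in>\<P>. Q \<noteq> Q' \<longrightarrow> {b \<in> Q. x \<in> blk b} \<inter> {b \<in> Q'. x \<in> blk b} = {}"
      using part by (auto simp: partition_on_def disjoint_def)
  qed
  also have "\<dots> = (\<Sum>Q\<in>\<P>. card {b \<in> P. x \<in> blk b})"
    using eq assms(5,6) unfolding equipartition_def by (intro sum.cong refl) blast
  finally show ?thesis
    using assms(3,4) by simp
qed

lemma cell_block_commute: "cell_block C R j i = cell_block R C i j"
  by (simp add: cell_block_def Int_commute)

lemma orthogonal_partitions_commute: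
  "orthogonal_partitions \<Q> \<P> \<longleftrightarrow> orthogonal_partitions \<P> \<Q>"
  unfolding orthogonal_partitions_def by (metis Int_commute)

lemma cell_block_in_cell:
  assumes "finite B" "partition_on B \<P>1" "partition_on B \<P>2"
    and "partition_type n n \<P>1" "partition_type n n \<P>2" "orthogonal_partitions \<P>1 \<P>2"
    and "R i \<in> \<P>1" "C j \<in> \<P>2"
  shows "R i \<inter> C j = {cell_block R C i j}"
proof -
  obtain b where "R i \<inter> C j = {b}"
    using ex1_block_in_cell[OF assms(1-8)] by blast
  then show ?thesis
    by (simp add: cell_block_def)
qed

text \<open>The column parts cut the row part \<open>R i\<close> into singletons: their disjointness
  gives injectivity, and their covering of \<open>B\<close> gives surjectivity. Exchanging the two
  partitions yields the statement for columns.\<close>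

lemma bij_betw_cell_block_row:
  assumes "finite B" "partition_on B \<P>1" "partition_on B \<P>2"
    and "partition_type n n \<P>1" "partition_type n n \<P>2" "orthogonal_partitions \<P>1 \<P>2"
    and "R i \<in> \<P>1" and C: "bij_betw C {..<n} \<P>2"
  shows "bij_betw (cell_block R C i) {..<n} (R i)"
proof -
  have mem: "C j \<in> \<P>2" if "j < n" for j
    using C that by (auto simp: bij_betw_def)
  have cell: "R i \<inter> C j = {cell_block R C i j}" if "j < n" for j
    using cell_block_in_cell[where R = R and C = C, OF assms(1-7) mem[OF that]] .
  show ?thesis
  proof (rule bij_betw_imageI)
    show "inj_on (cell_block R C i) {..<n}"
    proof (rule inj_onI)
      fix j j' assume *: "j \<in> {..<n}" "j' \<in> {..<n}" "cell_block R C i j = cell_block R C i j'"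
      then have "C j \<inter> C j' \<noteq> {}"
        using cell[of j] cell[of j'] by auto
      then have "C j = C j'"
        using * mem assms(3) by (auto simp: partition_on_def disjoint_def)
      then show "j = j'"
        using * C by (auto simp: bij_betw_def inj_on_def)
    qed
    show "cell_block R C i ` {..<n} = R i"
    proof
      show "cell_block R C i ` {..<n} \<subseteq> R i"
        using cell by auto
      show "R i \<subseteq> cell_block R C i ` {..<n}"
      proof
        fix b assume b: "b \<in> R i"
        then have "b \<in> \<Union>\<P>2"
          using assms(2,3,7) by (auto simp: partition_on_def)
        then obtain j where "j < n" "b \<in> C j"
          using C by (auto simp: bij_betw_def)
        then show "b \<in> cell_block R C i ` {..<n}"
          using b cell[of j] by auto
      qed
    qed
  qed
qed

text \<open>The row bijections glue together because the row parts are disjoint and cover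
  \<open>B\<close>.\<close>

lemma bij_betw_cell_block:
  assumes "finite B" "partition_on B \<P>1" "partition_on B \<P>2"
    and "partition_type n n \<P>1" "partition_type n n \<P>2" "orthogonal_partitions \<P>1 \<P>2"
    and R: "bij_betw R {..<n} \<P>1" and C: "bij_betw C {..<n} \<P>2"
  shows "bij_betw (\<lambda>(i, j). cell_block R C i j) ({..<n} \<times> {..<n}) B"
proof -
  have mem: "R i \<in> \<P>1" if "i < n" for i
    using R that by (auto simp: bij_betw_def)
  have row: "bij_betw (cell_block R C i) {..<n} (R i)" if "i < n" for i
    using bij_betw_cell_block_row[where R = R, OF assms(1-6) mem[OF that] C] .
  have in_row: "cell_block R C i j \<in> R i" if "i < n" "j < n" for i j
    using row[OF that(1)] that(2) by (auto simp: bij_betw_def)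
  show ?thesis
  proof (rule bij_betw_imageI)
    show "inj_on (\<lambda>(i, j). cell_block R C i j) ({..<n} \<times> {..<n})"
    proof (clarsimp simp: inj_on_def)
      fix i j i' j'
      assume *: "i < n" "j < n" "i' < n" "j' < n" "cell_block R C i j = cell_block R C i' j'"
      \<comment> \<open>The common label lies in both row parts.\<close>
      then have "R i \<inter> R i' \<noteq> {}"
        using in_row[of i j] in_row[of i' j'] by auto
      then have "R i = R i'"
        using * mem assms(2) by (auto simp: partition_on_def disjoint_def)
      then have "i = i'"
        using * R by (auto simp: bij_betw_def inj_on_def)
      then show "i = i' \<and> j = j'"
        using * row[of i] by (auto simp: bij_betw_def inj_on_def)
    qed
    have "(\<lambda>(i, j). cell_block R C i j) ` ({..<n} \<times> {..<n}) = (\<Union>i<n. cell_block R C i ` {..<n})"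
      by auto
    also have "\<dots> = (\<Union>i<n. R i)"
      using row by (auto simp: bij_betw_def)
    also have "\<dots> = B"
      using R assms(2) by (auto simp: bij_betw_def partition_on_def)
    finally show "(\<lambda>(i, j). cell_block R C i j) ` ({..<n} \<times> {..<n}) = B" .
  qed
qed

lemma point_square_index [simp]:
  assumes "i < n" and "j < n"
  shows "point_square blk n R C x $$ (i, j) = (if x \<in> blk (cell_block R C i j) then 1 else 0)"
  using assms by (simp add: point_square_def)

text \<open>A line is kept abstract, as a bijection \<open>g\<close> onto a part \<open>S\<close>,
  so that rows and columns are both instances. The subtraction \<open>n - l\<close> does not
  truncate, since the \<open>l\<close> ones occupy positions below \<open>n\<close>.\<close>

lemma card_ones_zeros_line:
  fixes f :: "nat \<Rightarrow> nat"
  assumes "bij_betw g {..<n} S" and "card {b \<in> S. x \<in> blk b} = l"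
    and f: "\<And>j. j < n \<Longrightarrow> f j = (if x \<in> blk (g j) then 1 else 0)"
  shows "card {j. j < n \<and> f j = 0} = n - l \<and> card {j. j < n \<and> f j = 1} = l"
proof -
  have "{j. j < n \<and> f j = 1} = {j \<in> {..<n}. x \<in> blk (g j)}"
    using f by (auto split: if_splits)
  then have ones: "card {j. j < n \<and> f j = 1} = l"
    using card_Collect_bij_betw[OF assms(1), of "\<lambda>b. x \<in> blk b"] assms(2) by simp
  have "{j. j < n \<and> f j = 0} = {..<n} - {j. j < n \<and> f j = 1}"
    using f by (auto split: if_splits)
  then have "card {j. j < n \<and> f j = 0} = n - card {j. j < n \<and> f j = 1}"
    by (simp add: card_Diff_subset subset_iff)
  with ones show ?thesis by simp
qed

theorem theorem3p3:
  fixes l1 n k :: nat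
    and V :: "'a set" and B :: "'b set" and blk :: "'b \<Rightarrow> 'a set"
    and \<P>1 \<P>2 :: "'b set set" and R C :: "nat \<Rightarrow> 'b set"
  assumes "0 < l1" and "0 < n"
    and "DK_design (l1 * n) (l1\<^sup>2) V B blk"
    and "card V = k" and "card B = n\<^sup>2"
    and "equipartition V B blk \<P>1" and "equipartition V B blk \<P>2"
    and "partition_type n n \<P>1" and "partition_type n n \<P>2"
    and "orthogonal_partitions \<P>1 \<P>2"
    and "bij_betw R {..<n} \<P>1" and "bij_betw C {..<n} \<P>2"
  shows "mutually_orthogonal_freq_squares n (n - l1) l1 V (point_square blk n R C) \<and>
         (l1 < n \<longrightarrow> card (point_square blk n R C ` V) = k)"
proof -
  let ?F = "point_square blk n R C"
  have finB: "finite B"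
    and point: "\<And>x. x \<in> V \<Longrightarrow> card {b \<in> B. x \<in> blk b} = l1 * n"
    and pair: "\<And>x y. x \<in> V \<Longrightarrow> y \<in> V \<Longrightarrow> x \<noteq> y \<Longrightarrow>
      card {b \<in> B. x \<in> blk b \<and> y \<in> blk b} = l1\<^sup>2"
    using assms(3) by (auto simp: DK_design_def design_def)
  have part: "partition_on B \<P>1" "partition_on B \<P>2"
    using assms(6,7) by (auto simp: equipartition_def)
  have card_parts: "card \<P>1 = n" "card \<P>2 = n"
    using assms(8,9) by (auto simp: partition_type_def)
  have memR: "R i \<in> \<P>1" and memC: "C i \<in> \<P>2" if "i < n" for i
    using assms(11,12) that by (auto simp: bij_betw_def)

  have row: "bij_betw (\<lambda>j. cell_block R C i j) {..<n} (R i)" if "i < n" for i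
    using bij_betw_cell_block_row[where R = R, OF finB part assms(8-10) memR[OF that] assms(12)] .
  \<comment> \<open>Columns are rows for the exchanged partitions; symmetry of
    \<open>cell_block\<close> rewrites the goal into that form.\<close>
  have col: "bij_betw (\<lambda>i. cell_block R C i j) {..<n} (C j)" if "j < n" for j
    using bij_betw_cell_block_row[where R = C, OF finB part(2,1) assms(9,8)
        assms(10)[THEN orthogonal_partitions_commute[THEN iffD2]] memC[OF that] assms(11)]
    unfolding cell_block_commute[of C R, THEN sym] .

  have square: "binary_freq_square n (n - l1) l1 (?F x)" if x: "x \<in> V" for x
    unfolding binary_freq_square_def
  proof (intro conjI[OF _ conjI[OF _ conjI]] allI impI)
    show "?F x \<in> carrier_mat n n"
      by (simp add: point_square_def)
    show "?F x $$ (i, j) \<in> {0, 1}" if "i < n" "j < n" for i j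
      using that by simp
    show "card {j. j < n \<and> ?F x $$ (i, j) = 0} = n - l1 \<and>
          card {j. j < n \<and> ?F x $$ (i, j) = 1} = l1" if i: "i < n" for i
      using i by (intro card_ones_zeros_line[OF row[OF i] card_blocks_through_point_in_part[OF
            finB assms(6) card_parts(1) assms(2) x memR[OF i] point[OF x]]]) simp
    show "card {i. i < n \<and> ?F x $$ (i, j) = 0} = n - l1 \<and>
          card {i. i < n \<and> ?F x $$ (i, j) = 1} = l1" if j: "j < n" for j
      using j by (intro card_ones_zeros_line[OF col[OF j] card_blocks_through_point_in_part[OF
            finB assms(7) card_parts(2) assms(2) x memC[OF j] point[OF x]]]) simp
  qed

  \<comment> \<open>The points need not be distinct: the case \<open>x = y\<close> counts all ones
    of a single square.\<close>
  have common: "card {(i, j). i < n \<and> j < n \<and> ?F x $$ (i, j) = 1 \<and> ?F y $$ (i, j) = 1} =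
      card {b \<in> B. x \<in> blk b \<and> y \<in> blk b}" for x y
  proof -
    have "{(i, j). i < n \<and> j < n \<and> ?F x $$ (i, j) = 1 \<and> ?F y $$ (i, j) = 1} =
      {p \<in> {..<n} \<times> {..<n}. x \<in> blk (case p of (i, j) \<Rightarrow> cell_block R C i j) \<and>
                              y \<in> blk (case p of (i, j) \<Rightarrow> cell_block R C i j)}" (is "?L = ?R")
    proof (rule Set.set_eqI)
      show "p \<in> ?L \<longleftrightarrow> p \<in> ?R" for p
        \<comment> \<open>The entry formula holds only inside the grid, hence the case split;
          outside it both memberships fail.\<close>
        by (cases p; cases "fst p < n \<and> snd p < n") auto
    qed
    then show ?thesis
      using card_Collect_bij_betw[OF bij_betw_cell_block[OF finB part assms(8-12)],
          of "\<lambda>b. x \<in> blk b \<and> y \<in> blk b"] by simp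
  qed

  have "inj_on ?F V" if "l1 < n"
  proof (rule inj_onI, rule ccontr)
    fix x y assume xy: "x \<in> V" "y \<in> V" "?F x = ?F y" "x \<noteq> y"
    \<comment> \<open>As the squares agree, the ones shared by \<open>?F x\<close> and
      \<open>?F y\<close> are all ones of \<open>?F x\<close>; they number \<open>l1\<^sup>2\<close>
      by the pair count and \<open>l1 * n\<close> by the point count.\<close>
    have "l1\<^sup>2 = l1 * n"
      using common[of x y] common[of x x] pair[OF xy(1,2,4)] point[OF xy(1)] xy(3) by simp
    then show False
      using that assms(1) by (simp add: power2_eq_square)
  qed
  then show ?thesis
    \<comment> \<open>Rewriting with \<open>common\<close> turns orthogonality into the pair count
      of the design.\<close>
    unfolding mutually_orthogonal_freq_squares_def orthogonal_freq_squares_def pairwise_def common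
    using square pair assms(4) by (simp add: card_image)
qed

end
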